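(* Let $0<d<1$ and $P=d\,P_s$, where $P_s$ is an $N\times N$ transition matrix (non-negative entries, each column summing to $1$), and let $B\in\mathbb{R}^N$. Consider the D-iteration for $(P,B)$ with the sequence $\mathcal{I}=\{i_1,i_2,\dots\}$ chosen according to either of the rules: (CYC) $i_n=n \bmod N$ (with values in $\{1,\dots,N\}$, residue $0$ being identified with $N$); (MAX) $i_n=\arg\max_i (F_{n-1})_i$. Then in both cases the convergence speed is at least $d^{\lfloor l/N\rfloor}$, where $l$ is the number of times diffusions are applied; that is, for all $l\ge0$, $$|F_l|\le d^{\lfloor l/N\rfloor}\,|F_0| .$$
   Context: For $X\in\mathbb{R}^N$, $|X|=\sum_{i=1}^N|x_i|$. Let $I$ be the $N\times N$ identity matrix and $J_i$ the matrix whose only non-zero entry is $(J_i)_{ii}=1$. The diffusion operators of $P$ are $P_i=I-J_i+PJ_i$. The D-iteration for $(P,B)$ and a sequence $\{i_1,i_2,\dots\}$ in $\{1,\dots,N\}$ is $F_0=B$, $H_0=0$ and, for $n\ge1$, $F_n=P_{i_n}F_{n-1}$, $H_n=H_{n-1}+J_{i_n}F_{n-1}$. The vector $F_n$ is the residual fluid, whose $L_1$-norm measures convergence.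
   Formalization: Rule (MAX) as stated fails for B with negative entries (N=2, B=(0,-1): index 1 is always the argmax and F never changes), so it is proved for B with non-negative entries and, for arbitrary B, with argmax of |(F_{n-1})_i| instead; (CYC) is proved for every B. *)

theory Defs
  imports Complex_Main "Jordan_Normal_Form.Matrix"
begin

(* The coordinates 1, ..., N of the mathematical text are the matrix indices
   0, ..., N - 1 of the library.  Diffusion sequences keep the values 1, ..., N,
   so coordinate j of a vector F is F $ (j - 1). *)

definition l1_norm :: "real vec \<Rightarrow> real" where
  "l1_norm X = (\<Sum>k<dim_vec X. \<bar>X $ k\<bar>)"

definition transition_matrix :: "nat \<Rightarrow> real mat \<Rightarrow> bool" where
  "transition_matrix N A \<longleftrightarrow>
     A \<in> carrier_mat N N \<and>
     (\<forall>r<N. \<forall>c<N. 0 \<le> A $$ (r, c)) \<and>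
     (\<forall>c<N. (\<Sum>r<N. A $$ (r, c)) = 1)"

definition unit_diag :: "nat \<Rightarrow> nat \<Rightarrow> real mat" where
  "unit_diag N j = mat N N (\<lambda>(r, c). if r = j - 1 \<and> c = j - 1 then 1 else 0)"

definition diffusion_op :: "nat \<Rightarrow> real mat \<Rightarrow> nat \<Rightarrow> real mat" where
  "diffusion_op N P j = 1\<^sub>m N - unit_diag N j + P * unit_diag N j"

(* The sequence i is used at the indices n \<ge> 1 only; i 0 is irrelevant. *)

primrec fluid :: "real mat \<Rightarrow> real vec \<Rightarrow> (nat \<Rightarrow> nat) \<Rightarrow> nat \<Rightarrow> real vec" where
  "fluid P B i 0 = B"
| "fluid P B i (Suc n) = diffusion_op (dim_vec B) P (i (Suc n)) *\<^sub>v fluid P B i n"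

primrec history :: "real mat \<Rightarrow> real vec \<Rightarrow> (nat \<Rightarrow> nat) \<Rightarrow> nat \<Rightarrow> real vec" where
  "history P B i 0 = 0\<^sub>v (dim_vec B)"
| "history P B i (Suc n) =
     history P B i n + unit_diag (dim_vec B) (i (Suc n)) *\<^sub>v fluid P B i n"

definition cyclic_rule :: "nat \<Rightarrow> (nat \<Rightarrow> nat) \<Rightarrow> bool" where
  "cyclic_rule N i \<longleftrightarrow>
     (\<forall>n\<ge>1. i n = (if n mod N = 0 then N else n mod N))"

(* Ties may be broken arbitrarily in both greedy rules.  The rule max_rule compares
   signed values.  For B with negative entries it gives no contraction: for N = 2 and
   B = (0, -1) the constant sequence 1 obeys it and never changes the fluid.  The rule
   max_abs_rule compares absolute values; it agrees with max_rule as long as the fluid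
   is non-negative, which is the case when P and B are. *)

definition max_rule :: "real mat \<Rightarrow> real vec \<Rightarrow> (nat \<Rightarrow> nat) \<Rightarrow> bool" where
  "max_rule P B i \<longleftrightarrow>
     (\<forall>n\<ge>1. is_arg_max (\<lambda>j. fluid P B i (n - 1) $ (j - 1)) (\<lambda>j. j \<in> {1..dim_vec B}) (i n))"

definition max_abs_rule :: "real mat \<Rightarrow> real vec \<Rightarrow> (nat \<Rightarrow> nat) \<Rightarrow> bool" where
  "max_abs_rule P B i \<longleftrightarrow>
     (\<forall>n\<ge>1. is_arg_max (\<lambda>j. \<bar>fluid P B i (n - 1) $ (j - 1)\<bar>) (\<lambda>j. j \<in> {1..dim_vec B}) (i n))"

end

theory Submission
  imports Defs
begin

text \<open>
  The decay by a factor \<open>d\<close> over \<open>N\<close> consecutive diffusions comes from a potential that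
  charges the gain in advance. Given a set \<open>S\<close> of coordinates regarded as already treated,
  weigh the fluid at a treated coordinate by 1 and at any other coordinate by \<open>d\<close>. With
  \<open>S\<close> empty the potential is \<open>d\<close> times the norm of the fluid; with \<open>S\<close> full it is the norm
  itself. It therefore suffices to let \<open>S\<close> grow by one coordinate per diffusion without ever
  increasing the potential.

  Diffusing a coordinate \<open>j\<close> of weight 1 that holds \<open>f\<close> removes \<open>\<bar>f\<bar>\<close> and puts back at
  most \<open>d * \<bar>f\<bar>\<close>, because the columns of \<open>P\<close> sum to \<open>d\<close> and no weight exceeds 1; cancellation
  between signs only helps. The profit \<open>(1 - d) * \<bar>f\<bar>\<close> pays exactly for raising the weight of
  one untreated coordinate \<open>k\<close> from \<open>d\<close> to 1, provided that \<open>k\<close> holds at most \<open>\<bar>f\<bar>\<close>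
  (\<open>potential_diffusion_le\<close>). Under the cyclic rule \<open>k = j\<close> always works within a period.
  Under the greedy rule on absolute values \<open>k = j\<close> works if \<open>j\<close> is untreated, and any untreated
  \<open>k\<close> works otherwise, as \<open>j\<close> is a maximum. A non-negative fluid stays non-negative, so that
  the signed greedy rule is then the same as the absolute one.
\<close>

section \<open>The potential\<close>

definition potential :: "real \<Rightarrow> nat set \<Rightarrow> real vec \<Rightarrow> real" where
  "potential d S X = (\<Sum>k<dim_vec X. (if k \<in> S then 1 else d) * \<bar>X $ k\<bar>)"

lemma potential_empty: "potential d {} X = d * l1_norm X"
  by (simp add: potential_def l1_norm_def sum_distrib_left)

lemma potential_full: "potential d {..<dim_vec X} X = l1_norm X"
  by (simp add: potential_def l1_norm_def)

lemma potential_insert: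
  assumes "k < dim_vec X" "k \<notin> S"
  shows "potential d (insert k S) X = potential d S X + (1 - d) * \<bar>X $ k\<bar>"
proof -
  have "potential d (insert k S) X
      = (\<Sum>m<dim_vec X. (if m \<in> S then 1 else d) * \<bar>X $ m\<bar>
          + (if m = k then (1 - d) * \<bar>X $ k\<bar> else 0))"
    unfolding potential_def using assms by (intro sum.cong) (auto simp: algebra_simps)
  then show ?thesis
    using assms by (simp add: potential_def sum.distrib)
qed

section \<open>Diffusion in coordinates\<close>

lemma diffusion_op_carrier:
  assumes "P \<in> carrier_mat N N" "X \<in> carrier_vec N"
  shows "diffusion_op N P j *\<^sub>v X \<in> carrier_vec N"
proof -
  have "diffusion_op N P j \<in> carrier_mat N N"
    unfolding diffusion_op_def using assms(1)
    by (intro add_carrier_mat mult_carrier_mat[of _ N N]) (auto simp: unit_diag_def)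
  then show ?thesis using assms(2) by (rule mult_mat_vec_carrier)
qed

lemma fluid_carrier:
  assumes "P \<in> carrier_mat N N" "B \<in> carrier_vec N"
  shows "fluid P B i n \<in> carrier_vec N"
  using assms(2) diffusion_op_carrier[OF assms(1)] by (induction n) auto

lemma diffusion_op_nth:
  assumes P: "P \<in> carrier_mat N N" and X: "X \<in> carrier_vec N"
    and j: "j \<in> {1..N}" and r: "r < N"
  shows "(diffusion_op N P j *\<^sub>v X) $ r
       = (if r = j - 1 then 0 else X $ r) + P $$ (r, j - 1) * X $ (j - 1)"
proof -
  let ?J = "unit_diag N j"
  have J: "?J \<in> carrier_mat N N" by (simp add: unit_diag_def)
  have Jx: "(?J *\<^sub>v X) $ s = (if s = j - 1 then X $ (j - 1) else 0)" if "s < N" for s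
  proof -
    have "(?J *\<^sub>v X) $ s = (\<Sum>c<N. (if s = j - 1 \<and> c = j - 1 then 1 else 0) * X $ c)"
      using that X by (simp add: unit_diag_def scalar_prod_def atLeast0LessThan)
    also have "\<dots> = (\<Sum>c<N. if c = j - 1 then (if s = j - 1 then X $ c else 0) else 0)"
      by (intro sum.cong) auto
    finally have "(?J *\<^sub>v X) $ s = \<dots>" .
    then show ?thesis using j by auto
  qed
  have "(P *\<^sub>v (?J *\<^sub>v X)) $ r = (\<Sum>c<N. P $$ (r, c) * (?J *\<^sub>v X) $ c)"
    using P J r by (simp add: scalar_prod_def atLeast0LessThan)
  also have "\<dots> = (\<Sum>c<N. if c = j - 1 then P $$ (r, c) * X $ (j - 1) else 0)"
    using Jx by (intro sum.cong) (auto simp del: index_mult_mat_vec)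
  finally have "(P *\<^sub>v (?J *\<^sub>v X)) $ r = \<dots>" .
  then have PJx: "(P *\<^sub>v (?J *\<^sub>v X)) $ r = P $$ (r, j - 1) * X $ (j - 1)"
    using j by auto
  have "diffusion_op N P j *\<^sub>v X = (1\<^sub>m N - ?J) *\<^sub>v X + (P * ?J) *\<^sub>v X"
    unfolding diffusion_op_def
    by (rule add_mult_distrib_mat_vec[OF minus_carrier_mat[OF J] mult_carrier_mat[OF P J] X])
  also have "(1\<^sub>m N - ?J) *\<^sub>v X = X - ?J *\<^sub>v X"
    using minus_mult_distrib_mat_vec[OF one_carrier_mat J X] X by simp
  also have "(P * ?J) *\<^sub>v X = P *\<^sub>v (?J *\<^sub>v X)"
    by (rule assoc_mult_mat_vec[OF P J X])
  finally have "diffusion_op N P j *\<^sub>v X = (X - ?J *\<^sub>v X) + P *\<^sub>v (?J *\<^sub>v X)" .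
  moreover have "((X - ?J *\<^sub>v X) + P *\<^sub>v (?J *\<^sub>v X)) $ r
      = X $ r - (?J *\<^sub>v X) $ r + (P *\<^sub>v (?J *\<^sub>v X)) $ r"
    using P X J r by (simp del: index_mult_mat_vec)
  ultimately show ?thesis using PJx Jx[OF r] by (auto simp del: index_mult_mat_vec)
qed

section \<open>One diffusion does not increase the potential\<close>

locale damped_transition =
  fixes N :: nat and d :: real and P Ps :: "real mat"
  assumes d: "0 < d" "d < 1"
    and Ps: "transition_matrix N Ps"
    and P_eq: "P = d \<cdot>\<^sub>m Ps"
begin

lemma P_carrier: "P \<in> carrier_mat N N"
  using Ps by (simp add: P_eq transition_matrix_def)

lemma P_nonneg: "r < N \<Longrightarrow> c < N \<Longrightarrow> 0 \<le> P $$ (r, c)"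
  using Ps d by (auto simp: P_eq transition_matrix_def)

lemma P_column_sum: "c < N \<Longrightarrow> (\<Sum>r<N. P $$ (r, c)) = d"
  using Ps by (auto simp: P_eq transition_matrix_def simp flip: sum_distrib_left)

text \<open>
  The fluid at \<open>j\<close> leaves with weight 1. What comes back is spread along a column of \<open>P\<close>, whose
  sum is \<open>d\<close>, over coordinates of weight at most 1.
\<close>

lemma potential_diffusion_gain:
  assumes X: "X \<in> carrier_vec N" and j: "j \<in> {1..N}" and jS: "j - 1 \<in> S"
  shows "potential d S (diffusion_op N P j *\<^sub>v X) \<le> potential d S X - (1 - d) * \<bar>X $ (j - 1)\<bar>"
proof -
  let ?f = "\<bar>X $ (j - 1)\<bar>" and ?w = "\<lambda>k. if k \<in> S then 1 else d"
  have j1: "j - 1 < N" using j by auto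
  have le: "?w r * \<bar>(diffusion_op N P j *\<^sub>v X) $ r\<bar>
      \<le> ?w r * \<bar>X $ r\<bar> - (if r = j - 1 then ?f else 0) + P $$ (r, j - 1) * ?f" if r: "r < N" for r
  proof -
    have p: "0 \<le> P $$ (r, j - 1) * ?f" using P_nonneg[OF r j1] by simp
    have "\<bar>(diffusion_op N P j *\<^sub>v X) $ r\<bar>
        \<le> (if r = j - 1 then 0 else \<bar>X $ r\<bar>) + P $$ (r, j - 1) * ?f"
      unfolding diffusion_op_nth[OF P_carrier X j r]
      using abs_triangle_ineq[of "X $ r" "P $$ (r, j - 1) * X $ (j - 1)"] P_nonneg[OF r j1]
      by (auto simp: abs_mult)
    then have "?w r * \<bar>(diffusion_op N P j *\<^sub>v X) $ r\<bar>
        \<le> ?w r * ((if r = j - 1 then 0 else \<bar>X $ r\<bar>) + P $$ (r, j - 1) * ?f)"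
      using d by (intro mult_left_mono) auto
    also have "\<dots> = ?w r * \<bar>X $ r\<bar> - (if r = j - 1 then ?f else 0) + ?w r * (P $$ (r, j - 1) * ?f)"
      using jS by (auto simp: algebra_simps)
    also have "?w r * (P $$ (r, j - 1) * ?f) \<le> P $$ (r, j - 1) * ?f"
      using p d by (intro mult_left_le_one_le) auto
    finally show ?thesis by simp
  qed
  have "potential d S (diffusion_op N P j *\<^sub>v X) = (\<Sum>r<N. ?w r * \<bar>(diffusion_op N P j *\<^sub>v X) $ r\<bar>)"
    using carrier_vecD[OF diffusion_op_carrier[OF P_carrier X, of j]] by (simp only: potential_def)
  also have "\<dots> \<le> (\<Sum>r<N. ?w r * \<bar>X $ r\<bar> - (if r = j - 1 then ?f else 0) + P $$ (r, j - 1) * ?f)"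
    using le by (intro sum_mono) auto
  also have "\<dots> = potential d S X - ?f + d * ?f"
  proof -
    have "(\<Sum>r<N. P $$ (r, j - 1) * ?f) = d * ?f"
      using P_column_sum[OF j1] by (simp flip: sum_distrib_right)
    moreover have "(\<Sum>r<N. if r = j - 1 then ?f else 0) = ?f"
      using j1 by (simp add: sum.delta)
    ultimately show ?thesis
      using X by (simp only: sum.distrib sum_subtractf potential_def carrier_vecD)
  qed
  finally show ?thesis by (simp add: algebra_simps)
qed

lemma l1_norm_diffusion_le:
  assumes X: "X \<in> carrier_vec N" and j: "j \<in> {1..N}"
  shows "l1_norm (diffusion_op N P j *\<^sub>v X) \<le> l1_norm X"
proof -
  have "0 \<le> (1 - d) * \<bar>X $ (j - 1)\<bar>" using d by simp
  moreover have "j - 1 \<in> {..<N}" using j by auto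
  ultimately show ?thesis
    using potential_diffusion_gain[OF X j, of "{..<N}"] potential_full[of d X]
      potential_full[of d "diffusion_op N P j *\<^sub>v X"]
      carrier_vecD[OF X] carrier_vecD[OF diffusion_op_carrier[OF P_carrier X, of j]] by simp
qed

text \<open>
  The exchange at the heart of the argument: the gain from diffusing \<open>j\<close> pays for treating
  \<open>k\<close> as well. The gain is only available if \<open>j\<close> has weight 1 afterwards, so an
  untreated \<open>j\<close> has to be chosen as \<open>k\<close> itself.
\<close>

lemma potential_diffusion_le:
  assumes X: "X \<in> carrier_vec N" and j: "j \<in> {1..N}"
    and k: "k < N" "k \<notin> S" and jk: "j - 1 \<in> insert k S"
    and le: "\<bar>X $ k\<bar> \<le> \<bar>X $ (j - 1)\<bar>"
  shows "potential d (insert k S) (diffusion_op N P j *\<^sub>v X) \<le> potential d S X"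
proof -
  have "(1 - d) * \<bar>X $ k\<bar> \<le> (1 - d) * \<bar>X $ (j - 1)\<bar>"
    using le d by (intro mult_left_mono) auto
  then show ?thesis
    using potential_diffusion_gain[OF X j jk] potential_insert[of k X S d] k carrier_vecD[OF X]
    by simp
qed

section \<open>Decay over \<open>N\<close> consecutive diffusions\<close>

context
  fixes B :: "real vec" and i :: "nat \<Rightarrow> nat"
  assumes B: "B \<in> carrier_vec N"
begin

lemma fluid_Suc: "fluid P B i (Suc n) = diffusion_op N P (i (Suc n)) *\<^sub>v fluid P B i n"
  using carrier_vecD[OF B] by simp

lemmas fluid_in_carrier = fluid_carrier[OF P_carrier B]

lemma cyclic_rule_range:
  assumes "1 \<le> N" "cyclic_rule N i" "1 \<le> n"
  shows "i n \<in> {1..N}"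
  using assms mod_less_divisor[of N n] by (auto simp: cyclic_rule_def)

lemma max_abs_rule_range: "max_abs_rule P B i \<Longrightarrow> 1 \<le> n \<Longrightarrow> i n \<in> {1..N}"
  using carrier_vecD[OF B] by (auto simp: max_abs_rule_def is_arg_max_def)

lemma max_abs_rule_max:
  assumes "max_abs_rule P B i" "k < N"
  shows "\<bar>fluid P B i n $ k\<bar> \<le> \<bar>fluid P B i n $ (i (Suc n) - 1)\<bar>"
proof -
  have "is_arg_max (\<lambda>j. \<bar>fluid P B i n $ (j - 1)\<bar>) (\<lambda>j. j \<in> {1..N}) (i (Suc n))"
    using assms(1) carrier_vecD[OF B] unfolding max_abs_rule_def
    by (metis diff_Suc_1 le_add1 plus_1_eq_Suc)
  moreover have "Suc k \<in> {1..N}" using assms(2) by simp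
  ultimately show ?thesis
    unfolding is_arg_max_def by (metis diff_Suc_1 not_le)
qed

lemma cyclic_rule_block:
  assumes N: "1 \<le> N" and cyc: "cyclic_rule N i"
  shows "l1_norm (fluid P B i (q * N + N)) \<le> d * l1_norm (fluid P B i (q * N))"
proof -
  have "potential d {..<m} (fluid P B i (q * N + m)) \<le> d * l1_norm (fluid P B i (q * N))"
    if "m \<le> N" for m
    using that
  proof (induction m)
    case 0
    then show ?case by (simp add: potential_empty)
  next
    case (Suc m)
    have im: "i (Suc (q * N + m)) = Suc m"
    proof (cases "Suc m = N")
      case True
      then have "Suc (q * N + m) = (q + 1) * N" by simp
      then have "Suc (q * N + m) mod N = 0" by (metis mod_mult_self2_is_0)
      then show ?thesis using cyc True by (simp add: cyclic_rule_def)
    next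
      case False
      then have "Suc (q * N + m) mod N = Suc m"
        using Suc.prems mod_mult_self3[of q N "Suc m"] by simp
      then show ?thesis using cyc by (simp add: cyclic_rule_def)
    qed
    have "potential d (insert m {..<m}) (diffusion_op N P (Suc m) *\<^sub>v fluid P B i (q * N + m))
        \<le> potential d {..<m} (fluid P B i (q * N + m))"
      using Suc.prems by (intro potential_diffusion_le[OF fluid_in_carrier]) auto
    then show ?case
      using Suc fluid_Suc[of "q * N + m"] im by (simp add: lessThan_Suc)
  qed
  from this[of N] show ?thesis
    using potential_full[of d "fluid P B i (q * N + N)"] carrier_vecD[OF fluid_in_carrier] by simp
qed

text \<open>
  The set of treated coordinates depends on the course of the iteration, so the induction
  tracks only its size; after \<open>N\<close> diffusions the size alone forces the set to be full.
\<close>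

lemma max_abs_rule_block:
  assumes max: "max_abs_rule P B i"
  shows "l1_norm (fluid P B i (n + N)) \<le> d * l1_norm (fluid P B i n)"
proof -
  have "\<exists>S \<subseteq> {..<N}. card S = m \<and> potential d S (fluid P B i (n + m)) \<le> d * l1_norm (fluid P B i n)"
    if "m \<le> N" for m
    using that
  proof (induction m)
    case 0
    then show ?case by (intro exI[of _ "{}"]) (simp add: potential_empty)
  next
    case (Suc m)
    then obtain S where S: "S \<subseteq> {..<N}" "card S = m"
      and pot: "potential d S (fluid P B i (n + m)) \<le> d * l1_norm (fluid P B i n)" by auto
    let ?j = "i (Suc (n + m))"
    have j: "?j \<in> {1..N}" using max by (intro max_abs_rule_range) auto
    have fin: "finite S" using S(1) finite_subset by blast
    obtain k where k: "k < N" "k \<notin> S" "?j - 1 \<in> insert k S"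
    proof (cases "?j - 1 \<in> S")
      case True
      have "S \<noteq> {..<N}" using S(2) Suc.prems by auto
      then show ?thesis using S(1) True that by blast
    next
      case False
      moreover have "?j - 1 < N" using j by auto
      ultimately show ?thesis using that by blast
    qed
    have "potential d (insert k S) (fluid P B i (n + Suc m)) \<le> potential d S (fluid P B i (n + m))"
      using potential_diffusion_le[OF fluid_in_carrier j k max_abs_rule_max[OF max k(1)]]
        fluid_Suc[of "n + m"] by simp
    then show ?case
      using pot S k fin by (intro exI[of _ "insert k S"]) auto
  qed
  then obtain S where "S \<subseteq> {..<N}" "card S = N"
    and pot: "potential d S (fluid P B i (n + N)) \<le> d * l1_norm (fluid P B i n)" by blast
  then have "S = {..<N}" by (simp add: card_subset_eq)
  then show ?thesis
    using pot potential_full[of d "fluid P B i (n + N)"] carrier_vecD[OF fluid_in_carrier] by simp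
qed

lemma fluid_nonneg:
  assumes "\<And>n. 1 \<le> n \<Longrightarrow> i n \<in> {1..N}" and "\<forall>k<N. 0 \<le> B $ k"
  shows "\<forall>k<N. 0 \<le> fluid P B i n $ k"
proof (induction n)
  case 0
  then show ?case using assms(2) by simp
next
  case (Suc n)
  have j: "i (Suc n) \<in> {1..N}" using assms(1) by simp
  then have "i (Suc n) - 1 < N" by auto
  then show ?case
    using Suc P_nonneg by (auto simp: fluid_Suc diffusion_op_nth[OF P_carrier fluid_in_carrier j]
        simp del: fluid.simps index_mult_mat_vec)
qed

lemma max_rule_imp_max_abs_rule:
  assumes max: "max_rule P B i" and nonneg: "\<forall>k<N. 0 \<le> B $ k"
  shows "max_abs_rule P B i"
proof -
  have range: "i n \<in> {1..N}" if "1 \<le> n" for n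
    using max that carrier_vecD[OF B] by (auto simp: max_rule_def is_arg_max_def)
  have "\<bar>fluid P B i n $ (j - 1)\<bar> = fluid P B i n $ (j - 1)" if "j \<in> {1..N}" for j n
  proof -
    have "j - 1 < N" using that by auto
    then show ?thesis using fluid_nonneg[OF range nonneg] by simp
  qed
  then show ?thesis
    using max carrier_vecD[OF B] unfolding max_rule_def max_abs_rule_def is_arg_max_def by auto
qed

text \<open>The diffusions of an unfinished last block do not increase the norm.\<close>

lemma l1_norm_fluid_le:
  assumes range: "\<And>n. 1 \<le> n \<Longrightarrow> i n \<in> {1..N}"
    and block: "\<And>q. l1_norm (fluid P B i (q * N + N)) \<le> d * l1_norm (fluid P B i (q * N))"
  shows "l1_norm (fluid P B i l) \<le> d ^ (l div N) * l1_norm (fluid P B i 0)"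
proof -
  have blocks: "l1_norm (fluid P B i (q * N)) \<le> d ^ q * l1_norm (fluid P B i 0)" for q
  proof (induction q)
    case (Suc q)
    have "d * l1_norm (fluid P B i (q * N)) \<le> d * (d ^ q * l1_norm (fluid P B i 0))"
      using Suc d by (intro mult_left_mono) auto
    then show ?case using block[of q] by (simp add: add.commute mult.assoc)
  qed simp
  have rest: "l1_norm (fluid P B i (n + r)) \<le> l1_norm (fluid P B i n)" for n r
  proof (induction r)
    case (Suc r)
    have "l1_norm (fluid P B i (Suc (n + r))) \<le> l1_norm (fluid P B i (n + r))"
      unfolding fluid_Suc using range by (intro l1_norm_diffusion_le fluid_in_carrier) simp
    then show ?case using Suc by simp
  qed simp
  have "l1_norm (fluid P B i l) \<le> l1_norm (fluid P B i (l div N * N))"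
    using rest[of "l div N * N" "l mod N"] by simp
  then show ?thesis using blocks[of "l div N"] by simp
qed

end

end

theorem theorem13:
  fixes N :: nat and d :: real and P Ps :: "real mat" and B :: "real vec"
    and i :: "nat \<Rightarrow> nat"
  assumes "N \<ge> 1"
    and "0 < d" and "d < 1"
    and "transition_matrix N Ps"
    and "P = d \<cdot>\<^sub>m Ps"
    and "B \<in> carrier_vec N"
    and "cyclic_rule N i
         \<or> max_abs_rule P B i
         \<or> (max_rule P B i \<and> (\<forall>k<N. 0 \<le> B $ k))"
  shows "\<forall>l. l1_norm (fluid P B i l) \<le> d ^ (l div N) * l1_norm (fluid P B i 0)"
proof -
  interpret damped_transition N d P Ps
    using assms by unfold_locales
  have "cyclic_rule N i \<or> max_abs_rule P B i"
    using assms(7) max_rule_imp_max_abs_rule[OF assms(6)] by blast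
  then show ?thesis
  proof
    assume cyc: "cyclic_rule N i"
    show ?thesis
      using l1_norm_fluid_le[OF assms(6)] cyclic_rule_range[OF assms(6,1) cyc]
        cyclic_rule_block[OF assms(6,1) cyc] by blast
  next
    assume max: "max_abs_rule P B i"
    show ?thesis
      using l1_norm_fluid_le[OF assms(6)] max_abs_rule_range[OF assms(6) max]
        max_abs_rule_block[OF assms(6) max] by blast
  qed
qed

end
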